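(* Any online $k$-server algorithm that is $O(1)$-multiplicatively fair and $O(k)$-competitive is $O(1)$-acceptably fair.
   Context: $k$-server problem: $k$ servers in a metric space serve an online request sequence $\sigma$; moving costs the distance traveled; $c_i(A,\sigma)$ is server $i$'s total cost under algorithm $A$; $\mathrm{cost}(A,\sigma)=\sum_i c_i(A,\sigma)$; $\mathrm{OPT}(\sigma)$ is the optimal offline total cost. $A$ is $c$-competitive if $\mathrm{cost}(A,\sigma)\le c\cdot\mathrm{OPT}(\sigma)+C$ for a constant $C$ and all $\sigma$. $A$ is $\alpha$-multiplicatively fair if for all $\sigma$, $\max_{i,j}c_i(A,\sigma)/c_j(A,\sigma)\le\alpha$. $A$ is $\gamma$-acceptably fair if for all $\sigma$, $\max_i c_i(A,\sigma)\le\gamma\cdot\mathrm{OPT}(\sigma)$. Here $O(1)$ and $O(k)$ denote quantities bounded by a constant, resp. a constant times $k$, with constants independent of $k$ and $\sigma$.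
   Formalization: Competitiveness with an additive constant C cannot give acceptable fairness without one (OPT can be 0 while servers move); proved instead: with C = 0 the algorithm is O(1)-acceptably fair exactly, and with arbitrary C it is so up to an additive constant. *)

theory Defs
  imports "HOL-Analysis.Analysis"
begin

text \<open>
  An instance of the \<open>k\<close>-server problem is a metric space \<open>(M, d)\<close> together with a number \<open>k\<close> of
  servers and an initial configuration \<open>s\<close>. The servers are identified individually, by the
  numbers below \<open>k\<close>; only the values of a configuration at these numbers matter.
\<close>

type_synonym 'a configuration = "nat \<Rightarrow> 'a"

definition is_configuration :: "'a set \<Rightarrow> nat \<Rightarrow> 'a configuration \<Rightarrow> bool" where
  "is_configuration M k c \<longleftrightarrow> c ` {..<k} \<subseteq> M"

definition k_server_instance ::
  "'a set \<Rightarrow> ('a \<Rightarrow> 'a \<Rightarrow> real) \<Rightarrow> nat \<Rightarrow> 'a configuration \<Rightarrow> bool" where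
  "k_server_instance M d k s \<longleftrightarrow> Metric_space M d \<and> 1 \<le> k \<and> is_configuration M k s"

text \<open>
  The reaction to one request is a finite list of configurations that are passed through one after
  the other, so servers may also make detours and superfluous moves, all of which are paid for.
  The request is served if, at some moment of the reaction, some server is at the requested point.
\<close>

type_synonym 'a reaction = "'a configuration list"

fun serves :: "'a set \<Rightarrow> nat \<Rightarrow> 'a configuration \<Rightarrow> 'a list \<Rightarrow> 'a reaction list \<Rightarrow> bool" where
  "serves M k c [] [] \<longleftrightarrow> True"
| "serves M k c (r # \<sigma>) (R # S) \<longleftrightarrow>
     (\<forall>c' \<in> set R. is_configuration M k c') \<and>
     (\<exists>c' \<in> set (c # R). \<exists>i<k. c' i = r) \<and>
     serves M k (last (c # R)) \<sigma> S"
| "serves M k c _ _ \<longleftrightarrow> False"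

fun distance_traveled ::
  "('a \<Rightarrow> 'a \<Rightarrow> real) \<Rightarrow> nat \<Rightarrow> 'a configuration \<Rightarrow> 'a configuration list \<Rightarrow> real" where
  "distance_traveled d i c [] = 0"
| "distance_traveled d i c (c' # cs) = d (c i) (c' i) + distance_traveled d i c' cs"

definition schedule_cost ::
  "('a \<Rightarrow> 'a \<Rightarrow> real) \<Rightarrow> nat \<Rightarrow> 'a configuration \<Rightarrow> 'a reaction list \<Rightarrow> real" where
  "schedule_cost d k s S = (\<Sum>i<k. distance_traveled d i s (concat S))"

definition OPT ::
  "'a set \<Rightarrow> ('a \<Rightarrow> 'a \<Rightarrow> real) \<Rightarrow> nat \<Rightarrow> 'a configuration \<Rightarrow> 'a list \<Rightarrow> real" where
  "OPT M d k s \<sigma> = (INF S \<in> {S. serves M k s \<sigma> S}. schedule_cost d k s S)"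

text \<open>
  An online algorithm maps the requests seen so far, including the current one, to the reaction to
  the current request.
\<close>

type_synonym 'a algorithm = "'a list \<Rightarrow> 'a reaction"

definition schedule :: "'a algorithm \<Rightarrow> 'a list \<Rightarrow> 'a reaction list" where
  "schedule A \<sigma> = map (\<lambda>n. A (take (Suc n) \<sigma>)) [0..<length \<sigma>]"

definition online_algorithm ::
  "'a set \<Rightarrow> nat \<Rightarrow> 'a configuration \<Rightarrow> 'a algorithm \<Rightarrow> bool" where
  "online_algorithm M k s A \<longleftrightarrow> (\<forall>\<sigma> \<in> lists M. serves M k s \<sigma> (schedule A \<sigma>))"

definition server_cost ::
  "('a \<Rightarrow> 'a \<Rightarrow> real) \<Rightarrow> 'a configuration \<Rightarrow> 'a algorithm \<Rightarrow> 'a list \<Rightarrow> nat \<Rightarrow> real" where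
  "server_cost d s A \<sigma> i = distance_traveled d i s (concat (schedule A \<sigma>))"

definition cost ::
  "('a \<Rightarrow> 'a \<Rightarrow> real) \<Rightarrow> nat \<Rightarrow> 'a configuration \<Rightarrow> 'a algorithm \<Rightarrow> 'a list \<Rightarrow> real" where
  "cost d k s A \<sigma> = (\<Sum>i<k. server_cost d s A \<sigma> i)"

definition competitive_with ::
  "'a set \<Rightarrow> ('a \<Rightarrow> 'a \<Rightarrow> real) \<Rightarrow> nat \<Rightarrow> 'a configuration \<Rightarrow> 'a algorithm \<Rightarrow> real \<Rightarrow> real \<Rightarrow> bool" where
  "competitive_with M d k s A c C \<longleftrightarrow>
     (\<forall>\<sigma> \<in> lists M. cost d k s A \<sigma> \<le> c * OPT M d k s \<sigma> + C)"

definition competitive ::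
  "'a set \<Rightarrow> ('a \<Rightarrow> 'a \<Rightarrow> real) \<Rightarrow> nat \<Rightarrow> 'a configuration \<Rightarrow> 'a algorithm \<Rightarrow> real \<Rightarrow> bool" where
  "competitive M d k s A c \<longleftrightarrow> (\<exists>C. competitive_with M d k s A c C)"

definition strictly_competitive ::
  "'a set \<Rightarrow> ('a \<Rightarrow> 'a \<Rightarrow> real) \<Rightarrow> nat \<Rightarrow> 'a configuration \<Rightarrow> 'a algorithm \<Rightarrow> real \<Rightarrow> bool" where
  "strictly_competitive M d k s A c \<longleftrightarrow> competitive_with M d k s A c 0"

text \<open>
  The cost ratios are taken in \<^typ>\<open>ereal\<close>, where \<open>x / 0 = \<infinity>\<close> for positive \<open>x\<close> and \<open>0 / 0 = 0\<close>;
  real division would make the ratio \<open>0\<close> whenever the second server has not moved.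
\<close>

definition multiplicatively_fair ::
  "'a set \<Rightarrow> ('a \<Rightarrow> 'a \<Rightarrow> real) \<Rightarrow> nat \<Rightarrow> 'a configuration \<Rightarrow> 'a algorithm \<Rightarrow> real \<Rightarrow> bool" where
  "multiplicatively_fair M d k s A \<alpha> \<longleftrightarrow>
     (\<forall>\<sigma> \<in> lists M.
        (MAX (i, j) \<in> {..<k} \<times> {..<k}.
           ereal (server_cost d s A \<sigma> i) / ereal (server_cost d s A \<sigma> j)) \<le> ereal \<alpha>)"

definition acceptably_fair_with ::
  "'a set \<Rightarrow> ('a \<Rightarrow> 'a \<Rightarrow> real) \<Rightarrow> nat \<Rightarrow> 'a configuration \<Rightarrow> 'a algorithm \<Rightarrow> real \<Rightarrow> real \<Rightarrow> bool" where
  "acceptably_fair_with M d k s A \<gamma> C \<longleftrightarrow>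
     (\<forall>\<sigma> \<in> lists M. (MAX i \<in> {..<k}. server_cost d s A \<sigma> i) \<le> \<gamma> * OPT M d k s \<sigma> + C)"

definition acceptably_fair ::
  "'a set \<Rightarrow> ('a \<Rightarrow> 'a \<Rightarrow> real) \<Rightarrow> nat \<Rightarrow> 'a configuration \<Rightarrow> 'a algorithm \<Rightarrow> real \<Rightarrow> bool" where
  "acceptably_fair M d k s A \<gamma> \<longleftrightarrow> acceptably_fair_with M d k s A \<gamma> 0"

text \<open>
  The same notion up to an additive constant, as in the definition of competitiveness. If that
  definition leaves room for a positive additive constant, an algorithm may move its servers even
  though \<^const>\<open>OPT\<close> is \<open>0\<close>, and then it is not acceptably fair without such a constant.
\<close>

definition acceptably_fair_up_to_constant ::
  "'a set \<Rightarrow> ('a \<Rightarrow> 'a \<Rightarrow> real) \<Rightarrow> nat \<Rightarrow> 'a configuration \<Rightarrow> 'a algorithm \<Rightarrow> real \<Rightarrow> bool" where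
  "acceptably_fair_up_to_constant M d k s A \<gamma> \<longleftrightarrow> (\<exists>C. acceptably_fair_with M d k s A \<gamma> C)"

end

theory Submission
  imports Defs
begin

text \<open>Averaging. Multiplicative fairness gives \<open>c_i\<close> \<le> \<alpha>
  \<open>c_j\<close> for every pair of servers. Summing over all j yields k \<open>c_i\<close> \<le>
  \<alpha> \<open>cost\<close>, so no server pays more than \<alpha> times the average.
  Competitiveness bounds the total by \<beta> k \<open>OPT\<close> + C, and division by k cancels
  the factor k, leaving \<open>c_i\<close> \<le> \<alpha> \<beta> \<open>OPT\<close> + \<alpha> C /
  k. The pairwise inequality is \<open>multiplicatively_fair_server_cost_le\<close>; the averaging
  is \<open>acceptably_fair_with_if_competitive_with\<close>.\<close>

lemma server_cost_nonneg:
  assumes "\<And>x y. 0 \<le> d x y"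
  shows "0 \<le> server_cost d s A \<sigma> i"
proof -
  have "0 \<le> distance_traveled d i c cs" for c cs
    by (induction cs arbitrary: c) (simp_all add: assms)
  then show ?thesis
    by (simp add: server_cost_def)
qed

text \<open>Clears denominators even when y = 0: a positive x would then make the extended quotient
  infinite, which no real \<alpha> bounds, so x = 0.\<close>

lemma le_mult_if_ereal_divide_le:
  fixes x y \<alpha> :: real
  assumes "0 \<le> x" "0 \<le> y" "ereal x / ereal y \<le> ereal \<alpha>"
  shows "x \<le> \<alpha> * y"
proof (cases "y = 0")
  case True
  then show ?thesis
    using assms by (cases "x = 0") (auto simp: divide_ereal_def)
next
  case False
  then show ?thesis
    using assms by (simp add: pos_divide_le_eq)
qed

lemma multiplicatively_fair_server_cost_le:
  assumes "k_server_instance M d k s" "multiplicatively_fair M d k s A \<alpha>"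
    and "\<sigma> \<in> lists M" "i < k" "j < k"
  shows "server_cost d s A \<sigma> i \<le> \<alpha> * server_cost d s A \<sigma> j"
proof (rule le_mult_if_ereal_divide_le)
  have "\<And>x y. 0 \<le> d x y"
    using assms(1) by (auto simp: k_server_instance_def intro: Metric_space.nonneg)
  then show "0 \<le> server_cost d s A \<sigma> i" "0 \<le> server_cost d s A \<sigma> j"
    by (blast intro: server_cost_nonneg)+
  let ?r = "\<lambda>(i, j). ereal (server_cost d s A \<sigma> i) / ereal (server_cost d s A \<sigma> j)"
  have "?r (i, j) \<le> Max (?r ` ({..<k} \<times> {..<k}))"
    using assms(4,5) by (intro Max_ge finite_imageI imageI) auto
  also have "\<dots> \<le> ereal \<alpha>"
    using assms(2,3) unfolding multiplicatively_fair_def by blast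
  finally show "ereal (server_cost d s A \<sigma> i) / ereal (server_cost d s A \<sigma> j) \<le> ereal \<alpha>"
    by simp
qed

text \<open>Needed to multiply the competitive bound by \<alpha>. The empty request sequence is the
  test case: no server moves, and every ratio is 0 / 0 = 0 in \<open>ereal\<close>, so the maximum,
  over a nonempty set since k \<ge> 1, is 0.\<close>

lemma multiplicatively_fair_nonneg:
  assumes "k_server_instance M d k s" "multiplicatively_fair M d k s A \<alpha>"
  shows "0 \<le> \<alpha>"
proof -
  have k: "{..<k} \<noteq> {}"
    using assms(1) by (auto simp: k_server_instance_def lessThan_empty_iff)
  let ?r = "\<lambda>(i, j). ereal (server_cost d s A [] i) / ereal (server_cost d s A [] j)"
  have "?r ` ({..<k} \<times> {..<k}) = {0}"
    using k by (auto simp: server_cost_def schedule_def image_iff)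
  moreover have "Max (?r ` ({..<k} \<times> {..<k})) \<le> ereal \<alpha>"
    using assms(2) lists.Nil unfolding multiplicatively_fair_def by blast
  ultimately show ?thesis
    by simp
qed

text \<open>Keeping the additive constant explicit serves both notions of competitiveness at once: C
  = 0 again yields additive constant 0.\<close>

lemma acceptably_fair_with_if_competitive_with:
  assumes inst: "k_server_instance M d k s"
    and fair: "multiplicatively_fair M d k s A \<alpha>"
    and comp: "competitive_with M d k s A (\<beta> * real k) C"
  shows "acceptably_fair_with M d k s A (\<alpha> * \<beta>) (\<alpha> * C / real k)"
  unfolding acceptably_fair_with_def
proof (intro ballI)
  fix \<sigma> assume \<sigma>: "\<sigma> \<in> lists M"
  have k: "1 \<le> k"
    using inst by (simp add: k_server_instance_def)
  have "server_cost d s A \<sigma> i \<le> \<alpha> * \<beta> * OPT M d k s \<sigma> + \<alpha> * C / real k" if "i < k" for i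
  proof -
    \<comment> \<open>The cost of server i is written k times so that each copy can be compared with
      a different server j.\<close>
    have "real k * server_cost d s A \<sigma> i = (\<Sum>j<k. server_cost d s A \<sigma> i)"
      by simp
    also have "\<dots> \<le> (\<Sum>j<k. \<alpha> * server_cost d s A \<sigma> j)"
      using multiplicatively_fair_server_cost_le[OF inst fair \<sigma> that] by (intro sum_mono) simp
    also have "\<dots> = \<alpha> * cost d k s A \<sigma>"
      by (simp add: cost_def sum_distrib_left)
    also have "\<dots> \<le> \<alpha> * (\<beta> * real k * OPT M d k s \<sigma> + C)"
      using comp \<sigma> multiplicatively_fair_nonneg[OF inst fair]
      by (intro mult_left_mono) (auto simp: competitive_with_def)
    finally show ?thesis
      using k by (simp add: field_simps)
  qed
  then show "(MAX i \<in> {..<k}. server_cost d s A \<sigma> i) \<le> \<alpha> * \<beta> * OPT M d k s \<sigma> + \<alpha> * C / real k"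
    using k by (subst Max_le_iff) (auto simp: lessThan_empty_iff)
qed

theorem theorem16:
  shows "\<forall>\<alpha> \<beta> :: real. \<exists>\<gamma> :: real.
    \<forall>(M :: 'a set) (d :: 'a \<Rightarrow> 'a \<Rightarrow> real) (k :: nat) (s :: 'a configuration) (A :: 'a algorithm).
      k_server_instance M d k s \<and> online_algorithm M k s A \<and> multiplicatively_fair M d k s A \<alpha> \<longrightarrow>
        (strictly_competitive M d k s A (\<beta> * real k) \<longrightarrow> acceptably_fair M d k s A \<gamma>) \<and>
        (competitive M d k s A (\<beta> * real k) \<longrightarrow> acceptably_fair_up_to_constant M d k s A \<gamma>)"
proof (intro allI)
  fix \<alpha> \<beta> :: real
  show "\<exists>\<gamma> :: real.
    \<forall>(M :: 'a set) (d :: 'a \<Rightarrow> 'a \<Rightarrow> real) (k :: nat) (s :: 'a configuration) (A :: 'a algorithm).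
      k_server_instance M d k s \<and> online_algorithm M k s A \<and> multiplicatively_fair M d k s A \<alpha> \<longrightarrow>
        (strictly_competitive M d k s A (\<beta> * real k) \<longrightarrow> acceptably_fair M d k s A \<gamma>) \<and>
        (competitive M d k s A (\<beta> * real k) \<longrightarrow> acceptably_fair_up_to_constant M d k s A \<gamma>)"
    \<comment> \<open>The witness \<alpha> \<beta> depends on neither the instance nor the
      algorithm; only the additive constant \<alpha> C / k does, and it is quantified inside
      \<open>acceptably_fair_up_to_constant\<close>.\<close>
    using acceptably_fair_with_if_competitive_with[where C = 0]
      acceptably_fair_with_if_competitive_with
    unfolding strictly_competitive_def acceptably_fair_def competitive_def
      acceptably_fair_up_to_constant_def
    by (intro exI[of _ "\<alpha> * \<beta>"]) (simp, blast)
qed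

end
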